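(* Let $\alpha,\beta,\gamma,\delta>0$ be the bar lengths of a planar 4-bar linkage of elliptic type, let $\sigma=\frac{\alpha+\beta+\gamma+\delta}{2}$ and $$M=\frac{\alpha\beta\gamma\delta}{(\sigma-\alpha)(\sigma-\beta)(\sigma-\gamma)(\sigma-\delta)}.$$ Then, for real configurations $(x,y,z,w)\in(\mathbb{R}\cup\{\infty\})^4$ of the linkage: there is a configuration with $x=\infty$ if and only if $(M-1)(\sigma-\alpha-\beta)<0$; there is a configuration with $y=\infty$ if and only if $(M-1)(\sigma-\beta-\gamma)<0$; there is a configuration with $z=\infty$ if and only if $(M-1)(\sigma-\gamma-\delta)<0$; there is a configuration with $w=\infty$ if and only if $(M-1)(\sigma-\delta-\alpha)<0$.
   Context: Bar lengths of a planar 4-bar linkage are positive reals each of which is strictly smaller than the sum of the other three. The linkage is of elliptic type if $\alpha-\beta+\gamma-\delta\neq0$, $\alpha-\beta-\gamma+\delta\neq0$ and $\alpha+\beta-\gamma-\delta\neq0$. The bars have lengths $\alpha,\beta,\gamma,\delta$ in counter-clockwise cyclic order. Configurations are described by rotational angles $\rho_x,\rho_y,\rho_z,\rho_w\in\mathbb{R}/2\pi\mathbb{Z}$, the (exterior) turning angles from bar $\alpha$ to $\beta$, from $\beta$ to $\gamma$, from $\gamma$ to $\delta$, and from $\delta$ to $\alpha$, respectively, when the closed quadrilateral is traversed once. Thus a quadruple of angles is a configuration if and only if $\rho_x+\rho_y+\rho_z+\rho_w\equiv 0 \pmod{2\pi}$ and $\beta+\gamma e^{i\rho_y}+\delta e^{i(\rho_y+\rho_z)}+\alpha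 e^{i(\rho_y+\rho_z+\rho_w)}=0$ (self-intersections are allowed). One writes $x=\tan\frac{\rho_x}{2}$, $y=\tan\frac{\rho_y}{2}$, $z=\tan\frac{\rho_z}{2}$, $w=\tan\frac{\rho_w}{2}$, with value $\infty$ when the angle is $\pi$; $\mathbb{R}\cup\{\infty\}$ is the one-point compactification of $\mathbb{R}$. *)

theory Defs
  imports "HOL-Analysis.Analysis" "HOL-Library.Real_Mod"
begin

definition linkage_lengths :: "real \<Rightarrow> real \<Rightarrow> real \<Rightarrow> real \<Rightarrow> bool" where
  "linkage_lengths \<alpha> \<beta> \<gamma> \<delta> \<longleftrightarrow>
     \<alpha> > 0 \<and> \<beta> > 0 \<and> \<gamma> > 0 \<and> \<delta> > 0 \<and>
     \<alpha> < \<beta> + \<gamma> + \<delta> \<and> \<beta> < \<alpha> + \<gamma> + \<delta> \<and> \<gamma> < \<alpha> + \<beta> + \<delta> \<and> \<delta> < \<alpha> + \<beta> + \<gamma>"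

definition elliptic_type :: "real \<Rightarrow> real \<Rightarrow> real \<Rightarrow> real \<Rightarrow> bool" where
  "elliptic_type \<alpha> \<beta> \<gamma> \<delta> \<longleftrightarrow>
     \<alpha> - \<beta> + \<gamma> - \<delta> \<noteq> 0 \<and> \<alpha> - \<beta> - \<gamma> + \<delta> \<noteq> 0 \<and> \<alpha> + \<beta> - \<gamma> - \<delta> \<noteq> 0"

text \<open>
  Angles in \<open>\<real>/2\<pi>\<int>\<close> are given by real representatives; all notions below are invariant
  under congruence modulo \<open>2\<pi>\<close>.
\<close>

definition angle_configuration ::
    "real \<Rightarrow> real \<Rightarrow> real \<Rightarrow> real \<Rightarrow> real \<Rightarrow> real \<Rightarrow> real \<Rightarrow> real \<Rightarrow> bool" where
  "angle_configuration \<alpha> \<beta> \<gamma> \<delta> \<rho>x \<rho>y \<rho>z \<rho>w \<longleftrightarrow>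
     [\<rho>x + \<rho>y + \<rho>z + \<rho>w = 0] (rmod (2 * pi)) \<and>
     complex_of_real \<beta> + of_real \<gamma> * cis \<rho>y + of_real \<delta> * cis (\<rho>y + \<rho>z)
       + of_real \<alpha> * cis (\<rho>y + \<rho>z + \<rho>w) = 0"

text \<open>
  The set \<open>\<real> \<union> {\<infinity>}\<close> is \<^typ>\<open>real option\<close> with \<^const>\<open>None\<close> as the point \<open>\<infinity>\<close>, the carrier of
  \<^term>\<open>Alexandroff_compactification (euclidean :: real topology)\<close>.
\<close>

definition half_tan :: "real \<Rightarrow> real option" where
  "half_tan \<rho> = (if [\<rho> = pi] (rmod (2 * pi)) then None else Some (tan (\<rho> / 2)))"

definition configurations ::
    "real \<Rightarrow> real \<Rightarrow> real \<Rightarrow> real \<Rightarrow> (real option \<times> real option \<times> real option \<times> real option) set"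
  where
  "configurations \<alpha> \<beta> \<gamma> \<delta> =
     {(half_tan \<rho>x, half_tan \<rho>y, half_tan \<rho>z, half_tan \<rho>w) | \<rho>x \<rho>y \<rho>z \<rho>w.
        angle_configuration \<alpha> \<beta> \<gamma> \<delta> \<rho>x \<rho>y \<rho>z \<rho>w}"

lemma cis_rcong: "[a = b] (rmod (2 * pi)) \<Longrightarrow> cis a = cis b"
  by (simp add: complex_eq_iff sin_rcong cos_rcong)

lemma angle_configuration_rcong:
  assumes "[\<rho>x = \<rho>x'] (rmod (2 * pi))" "[\<rho>y = \<rho>y'] (rmod (2 * pi))"
    and "[\<rho>z = \<rho>z'] (rmod (2 * pi))" "[\<rho>w = \<rho>w'] (rmod (2 * pi))"
  shows "angle_configuration \<alpha> \<beta> \<gamma> \<delta> \<rho>x \<rho>y \<rho>z \<rho>w \<longleftrightarrow>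
    angle_configuration \<alpha> \<beta> \<gamma> \<delta> \<rho>x' \<rho>y' \<rho>z' \<rho>w'"
proof -
  have s: "[\<rho>x + \<rho>y + \<rho>z + \<rho>w = \<rho>x' + \<rho>y' + \<rho>z' + \<rho>w'] (rmod (2 * pi))"
    using assms by (intro rcong_add)
  have "[\<rho>x + \<rho>y + \<rho>z + \<rho>w = 0] (rmod (2 * pi)) \<longleftrightarrow>
        [\<rho>x' + \<rho>y' + \<rho>z' + \<rho>w' = 0] (rmod (2 * pi))"
    using s rcong_trans rcong_sym by blast
  moreover have "cis \<rho>y = cis \<rho>y'" "cis (\<rho>y + \<rho>z) = cis (\<rho>y' + \<rho>z')"
    "cis (\<rho>y + \<rho>z + \<rho>w) = cis (\<rho>y' + \<rho>z' + \<rho>w')"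
    using assms by (auto intro!: cis_rcong rcong_add)
  ultimately show ?thesis by (simp add: angle_configuration_def)
qed

lemma half_tan_eq_None_iff: "half_tan \<rho> = None \<longleftrightarrow> [\<rho> = pi] (rmod (2 * pi))"
  by (simp add: half_tan_def)

lemma half_tan_eq_iff: "half_tan a = half_tan b \<longleftrightarrow> [a = b] (rmod (2 * pi))"
proof -
  have c: "cos (r / 2) \<noteq> 0" if "\<not> [r = pi] (rmod (2 * pi))" for r
  proof
    assume "cos (r / 2) = 0"
    then obtain i :: int where "r / 2 = of_int i * pi + pi / 2"
      by (auto simp: cos_zero_iff_int2)
    then have "pi = r + of_int (- i) * (2 * pi)"
      by (simp add: field_simps)
    then show False using that unfolding rcong_altdef by blast
  qed
  have t: "tan (a / 2) = tan (b / 2) \<longleftrightarrow> [a = b] (rmod (2 * pi))"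
    if "\<not> [a = pi] (rmod (2 * pi))" "\<not> [b = pi] (rmod (2 * pi))"
  proof -
    have "tan (a / 2) = tan (b / 2) \<longleftrightarrow> sin (b / 2 - a / 2) = 0"
      using c[OF that(1)] c[OF that(2)] unfolding sin_diff tan_def
      by (auto simp: frac_eq_eq mult.commute)
    also have "\<dots> \<longleftrightarrow> (\<exists>i::int. b / 2 - a / 2 = of_int i * pi)"
      by (simp add: sin_zero_iff_int2)
    also have "\<dots> \<longleftrightarrow> [a = b] (rmod (2 * pi))"
      unfolding rcong_altdef by (intro ex_cong1) (auto simp: field_simps)
    finally show ?thesis .
  qed
  show ?thesis
  proof (cases "[a = pi] (rmod (2 * pi)) \<or> [b = pi] (rmod (2 * pi))")
    case True
    then show ?thesis
      by (auto simp: half_tan_def rcong_def)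
  next
    case False
    then show ?thesis
      using t by (simp add: half_tan_def)
  qed
qed

end

(* A turning angle of pi between the bars of lengths a and b folds them onto a single segment of length
   |a - b|, so such a configuration exists iff |a - b|, c, d are the sides of a possibly degenerate
   triangle. Given the linkage inequalities this means |c - d| <= |a - b|, and ellipticity excludes
   equality. The sign condition then follows from the identity
   a b c d - (s - a)(s - b)(s - c)(s - d) = s (s - a - b)(s - b - c)(s - a - c) for s = (a + b + c + d)/2,
   together with (a - b)^2 - (c - d)^2 = - 4 (s - b - c)(s - a - c). The other three joints follow by
   cyclic relabelling of the bars. *)
theory Submission
  imports Defs
begin

text \<open>The closing sum takes the direction of bar \<open>\<beta>\<close> as 1. Taking that of
  bar \<open>\<gamma>\<close> instead divides it by \<open>cis \<rho>y\<close>, and since the total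
  turning is a multiple of \<open>2 * pi\<close>, the term of bar \<open>\<beta>\<close> then closes
  the cycle.\<close>

lemma angle_configuration_rotate:
  "angle_configuration \<alpha> \<beta> \<gamma> \<delta> \<rho>x \<rho>y \<rho>z \<rho>w \<longleftrightarrow> angle_configuration \<beta> \<gamma> \<delta> \<alpha> \<rho>y \<rho>z \<rho>w \<rho>x"
proof -
  let ?L = "complex_of_real \<beta> + of_real \<gamma> * cis \<rho>y + of_real \<delta> * cis (\<rho>y + \<rho>z)
    + of_real \<alpha> * cis (\<rho>y + \<rho>z + \<rho>w)"
  let ?R = "complex_of_real \<gamma> + of_real \<delta> * cis \<rho>z + of_real \<alpha> * cis (\<rho>z + \<rho>w)
    + of_real \<beta> * cis (\<rho>z + \<rho>w + \<rho>x)"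
  have "?L = cis \<rho>y * ?R" if "[\<rho>x + \<rho>y + \<rho>z + \<rho>w = 0] (rmod (2 * pi))"
  proof -
    have "cis (\<rho>x + \<rho>y + \<rho>z + \<rho>w) = 1"
      using cis_rcong[OF that] by simp
    then have "cis \<rho>x * cis \<rho>y * cis \<rho>z * cis \<rho>w = 1"
      by (simp add: cis_mult)
    then show ?thesis
      by (simp add: cis_mult [symmetric]) algebra
  qed
  moreover have "\<rho>y + \<rho>z + \<rho>w + \<rho>x = \<rho>x + \<rho>y + \<rho>z + \<rho>w"
    by simp
  ultimately show ?thesis
    unfolding angle_configuration_def by (metis cis_neq_zero mult_eq_0_iff)
qed

lemma configurations_rotate:
  "(x, y, z, w) \<in> configurations \<alpha> \<beta> \<gamma> \<delta> \<longleftrightarrow> (y, z, w, x) \<in> configurations \<beta> \<gamma> \<delta> \<alpha>"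
  unfolding configurations_def
  by (auto simp: angle_configuration_rotate[of \<alpha>])

text \<open>Law of cosines; the cosine term has a plus sign because \<open>t\<close> is an exterior
  angle.\<close>

lemma cmod_real_add_cis:
  "(cmod (of_real c + of_real r * cis t))\<^sup>2 = c\<^sup>2 + 2 * c * r * cos t + r\<^sup>2"
proof -
  have "(r * cos t)\<^sup>2 + (r * sin t)\<^sup>2 = r\<^sup>2"
    by (simp add: power_mult_distrib flip: distrib_left)
  then show ?thesis
    by (simp add: cmod_power2 power2_sum)
qed

lemma exists_triangle_cis:
  fixes a b c :: real
  assumes "c \<noteq> 0" "a > 0" "b > 0" "\<bar>a - b\<bar> \<le> \<bar>c\<bar>" "\<bar>c\<bar> \<le> a + b"
  shows "\<exists>s t. complex_of_real c + of_real a * cis s + of_real b * cis t = 0"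
proof -
  \<comment> \<open>The value that the law of cosines forces on \<open>cos s\<close> if the
    remaining side is to have length \<open>b\<close>.\<close>
  define k where "k = (b\<^sup>2 - c\<^sup>2 - a\<^sup>2) / (2 * c * a)"
  \<comment> \<open>Expanded, these bounds confine the numerator of \<open>k\<close> between plus
    and minus the absolute value of its denominator, whatever the sign of \<open>c\<close>.\<close>
  have "(\<bar>c\<bar> - a)\<^sup>2 \<le> b\<^sup>2" "b\<^sup>2 \<le> (\<bar>c\<bar> + a)\<^sup>2"
    using assms by (auto simp flip: abs_le_square_iff)
  then have "\<bar>b\<^sup>2 - c\<^sup>2 - a\<^sup>2\<bar> \<le> \<bar>2 * c * a\<bar>"
    using assms by (simp add: power2_sum power2_diff abs_mult)
  then have k: "\<bar>k\<bar> \<le> 1"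
    using assms by (simp add: k_def divide_le_eq_1)
  define v where "v = of_real c + of_real a * cis (arccos k)"
  have "2 * c * a * k = b\<^sup>2 - c\<^sup>2 - a\<^sup>2"
    using assms by (simp add: k_def)
  then have "(cmod v)\<^sup>2 = b\<^sup>2"
    unfolding v_def cmod_real_add_cis using k by (simp add: cos_arccos_abs)
  then have "cmod (- v) = b"
    using assms by (simp add: power2_eq_iff_nonneg)
  \<comment> \<open>The polar form of the closing vector supplies the second angle.\<close>
  then have "- v = of_real b * cis (Arg (- v))"
    using rcis_cmod_Arg[of "- v"] by (simp add: rcis_def)
  then have "v + of_real b * cis (Arg (- v)) = 0"
    by (metis add.right_inverse)
  then show ?thesis
    unfolding v_def by blast
qed

text \<open>Reverse triangle inequality. The companion bound
  \<open>\<bar>c\<bar> \<le> a + b\<close> comes from the linkage inequalities.\<close>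

lemma triangle_cis_imp:
  fixes a b c :: real
  assumes "complex_of_real c + of_real a * cis s + of_real b * cis t = 0" "a > 0" "b > 0"
  shows "\<bar>a - b\<bar> \<le> \<bar>c\<bar>"
proof -
  have "complex_of_real c = - (of_real a * cis s) - of_real b * cis t"
    using assms(1) by algebra
  then have "\<bar>c\<bar> = cmod (- (of_real a * cis s) - of_real b * cis t)"
    by (metis norm_of_real real_norm_def)
  moreover have "\<bar>cmod (- (of_real a * cis s)) - cmod (of_real b * cis t)\<bar> \<le> \<dots>"
    by (rule norm_triangle_ineq3)
  ultimately show ?thesis
    using assms by (simp add: norm_mult)
qed

text \<open>At \<open>\<rho>x = pi\<close> bars \<open>\<alpha>\<close> and \<open>\<beta>\<close>
  point in opposite directions, so the closing condition becomes that of a triangle with signed side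
  \<open>\<beta> - \<alpha>\<close>.\<close>

lemma folded_configuration_iff:
  fixes \<alpha> \<beta> \<gamma> \<delta> :: real
  assumes "linkage_lengths \<alpha> \<beta> \<gamma> \<delta>" "elliptic_type \<alpha> \<beta> \<gamma> \<delta>"
  shows "(\<exists>y z w. (None, y, z, w) \<in> configurations \<alpha> \<beta> \<gamma> \<delta>) \<longleftrightarrow> \<bar>\<gamma> - \<delta>\<bar> < \<bar>\<alpha> - \<beta>\<bar>"
proof
  assume "\<exists>y z w. (None, y, z, w) \<in> configurations \<alpha> \<beta> \<gamma> \<delta>"
  then obtain \<rho>x \<rho>y \<rho>z \<rho>w where \<rho>x: "[\<rho>x = pi] (rmod (2 * pi))"
    and conf: "angle_configuration \<alpha> \<beta> \<gamma> \<delta> \<rho>x \<rho>y \<rho>z \<rho>w"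
    by (auto simp: configurations_def half_tan_eq_None_iff dest: sym)
  have "cis (\<rho>x + \<rho>y + \<rho>z + \<rho>w) = 1"
    using conf cis_rcong[of _ 0] by (simp add: angle_configuration_def)
  then have "cis \<rho>x * cis (\<rho>y + \<rho>z + \<rho>w) = 1"
    by (simp add: cis_mult add.assoc)
  then have "cis (\<rho>y + \<rho>z + \<rho>w) = - 1"
    using cis_rcong[OF \<rho>x] by (simp add: minus_equation_iff)
  then have "complex_of_real (\<beta> - \<alpha>) + of_real \<gamma> * cis \<rho>y + of_real \<delta> * cis (\<rho>y + \<rho>z) = 0"
    using conf by (simp add: angle_configuration_def algebra_simps)
  then have "\<bar>\<gamma> - \<delta>\<bar> \<le> \<bar>\<beta> - \<alpha>\<bar>"
    using assms(1) by (intro triangle_cis_imp) (auto simp: linkage_lengths_def)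
  \<comment> \<open>Equality would mean \<open>\<gamma> - \<delta> = \<alpha> - \<beta>\<close> or
    its negative, both excluded by ellipticity.\<close>
  then show "\<bar>\<gamma> - \<delta>\<bar> < \<bar>\<alpha> - \<beta>\<bar>"
    using assms(2) by (auto simp: elliptic_type_def)
next
  assume less: "\<bar>\<gamma> - \<delta>\<bar> < \<bar>\<alpha> - \<beta>\<bar>"
  have pos: "\<gamma> > 0" "\<delta> > 0" and le: "\<bar>\<beta> - \<alpha>\<bar> \<le> \<gamma> + \<delta>"
    using assms(1) by (auto simp: linkage_lengths_def)
  obtain s t where
    st: "complex_of_real (\<beta> - \<alpha>) + of_real \<gamma> * cis s + of_real \<delta> * cis t = 0"
    \<comment> \<open>Strictness of \<open>less\<close> ensures that the side
      \<open>\<beta> - \<alpha>\<close> is nonzero.\<close>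
    using exists_triangle_cis[OF _ pos _ le] less by force
  have "cis (- pi) = - 1"
    by (simp add: complex_eq_iff)
  \<comment> \<open>Here \<open>s\<close> and \<open>t\<close> are the directions of bars
    \<open>\<gamma>\<close> and \<open>\<delta>\<close> relative to \<open>\<beta>\<close>, and
    turning angles are their differences. The last angle turns bar \<open>\<alpha>\<close> to
    direction \<open>- pi\<close> and makes the total 0.\<close>
  then have "angle_configuration \<alpha> \<beta> \<gamma> \<delta> pi s (t - s) (- pi - t)"
    using st by (simp add: angle_configuration_def algebra_simps)
  then have "(half_tan pi, half_tan s, half_tan (t - s), half_tan (- pi - t)) \<in> configurations \<alpha> \<beta> \<gamma> \<delta>"
    unfolding configurations_def by blast
  moreover have "half_tan pi = None"
    by (simp add: half_tan_def)
  ultimately show "\<exists>y z w. (None, y, z, w) \<in> configurations \<alpha> \<beta> \<gamma> \<delta>"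
    by metis
qed

text \<open>\<open>M - 1\<close> already contains the factor
  \<open>\<sigma> - \<alpha> - \<beta>\<close>, so multiplying by it once more produces a square,
  which does not affect the sign.\<close>

lemma fold_sign_condition:
  fixes \<alpha> \<beta> \<gamma> \<delta> \<sigma> M :: real
  assumes "linkage_lengths \<alpha> \<beta> \<gamma> \<delta>" "elliptic_type \<alpha> \<beta> \<gamma> \<delta>"
    and \<sigma>: "\<sigma> = (\<alpha> + \<beta> + \<gamma> + \<delta>) / 2"
    and M: "M = \<alpha> * \<beta> * \<gamma> * \<delta> / ((\<sigma> - \<alpha>) * (\<sigma> - \<beta>) * (\<sigma> - \<gamma>) * (\<sigma> - \<delta>))"
  shows "(M - 1) * (\<sigma> - \<alpha> - \<beta>) < 0 \<longleftrightarrow> \<bar>\<gamma> - \<delta>\<bar> < \<bar>\<alpha> - \<beta>\<bar>"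
proof -
  define P where "P = (\<sigma> - \<alpha>) * (\<sigma> - \<beta>) * (\<sigma> - \<gamma>) * (\<sigma> - \<delta>)"
  \<comment> \<open>The positive ratio between
    \<open>(M - 1) * (\<sigma> - \<alpha> - \<beta>)\<close> and the difference of squares.\<close>
  define K where "K = \<sigma> * (\<sigma> - \<alpha> - \<beta>)\<^sup>2 / (4 * P)"
  have "P > 0"
    using assms(1) by (simp add: P_def \<sigma> linkage_lengths_def)
  moreover have "\<sigma> > 0" "\<sigma> - \<alpha> - \<beta> \<noteq> 0"
    using assms(1,2) by (auto simp: \<sigma> linkage_lengths_def elliptic_type_def field_simps)
  ultimately have K: "K > 0"
    by (simp add: K_def)
  \<comment> \<open>Eliminating \<open>\<delta>\<close> leaves polynomial identities in the
    independent variables \<open>\<alpha>\<close>, \<open>\<beta>\<close>, \<open>\<gamma>\<close>,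
    \<open>\<sigma>\<close>.\<close>
  have \<delta>: "\<delta> = 2 * \<sigma> - \<alpha> - \<beta> - \<gamma>"
    using \<sigma> by simp
  have "\<alpha> * \<beta> * \<gamma> * \<delta> - P = \<sigma> * (\<sigma> - \<alpha> - \<beta>) * (\<sigma> - \<beta> - \<gamma>) * (\<sigma> - \<alpha> - \<gamma>)"
    unfolding P_def \<delta> by algebra
  moreover have "(\<gamma> - \<delta>)\<^sup>2 - (\<alpha> - \<beta>)\<^sup>2 = 4 * ((\<sigma> - \<beta> - \<gamma>) * (\<sigma> - \<alpha> - \<gamma>))"
    unfolding \<delta> by algebra
  ultimately have eq: "4 * ((\<alpha> * \<beta> * \<gamma> * \<delta> - P) * (\<sigma> - \<alpha> - \<beta>))
      = \<sigma> * (\<sigma> - \<alpha> - \<beta>)\<^sup>2 * ((\<gamma> - \<delta>)\<^sup>2 - (\<alpha> - \<beta>)\<^sup>2)"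
    by algebra
  have "M - 1 = (\<alpha> * \<beta> * \<gamma> * \<delta> - P) / P"
    using \<open>P > 0\<close> unfolding M P_def[symmetric] by (simp add: diff_divide_distrib)
  then have "(M - 1) * (\<sigma> - \<alpha> - \<beta>) = 4 * ((\<alpha> * \<beta> * \<gamma> * \<delta> - P) * (\<sigma> - \<alpha> - \<beta>)) / (4 * P)"
    by simp
  also have "\<dots> = K * ((\<gamma> - \<delta>)\<^sup>2 - (\<alpha> - \<beta>)\<^sup>2)"
    unfolding eq K_def by simp
  finally have "(M - 1) * (\<sigma> - \<alpha> - \<beta>) = K * ((\<gamma> - \<delta>)\<^sup>2 - (\<alpha> - \<beta>)\<^sup>2)" .
  then have "(M - 1) * (\<sigma> - \<alpha> - \<beta>) < 0 \<longleftrightarrow> (\<gamma> - \<delta>)\<^sup>2 < (\<alpha> - \<beta>)\<^sup>2"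
    using K by (simp add: mult_less_0_iff)
  then show ?thesis
    by (metis abs_le_square_iff linorder_not_le)
qed

lemma infinite_half_tan_iff:
  fixes \<alpha> \<beta> \<gamma> \<delta> \<sigma> M :: real
  assumes "linkage_lengths \<alpha> \<beta> \<gamma> \<delta>" "elliptic_type \<alpha> \<beta> \<gamma> \<delta>"
    and "\<sigma> = (\<alpha> + \<beta> + \<gamma> + \<delta>) / 2"
    and "M = \<alpha> * \<beta> * \<gamma> * \<delta> / ((\<sigma> - \<alpha>) * (\<sigma> - \<beta>) * (\<sigma> - \<gamma>) * (\<sigma> - \<delta>))"
  shows "(\<exists>y z w. (None, y, z, w) \<in> configurations \<alpha> \<beta> \<gamma> \<delta>) \<longleftrightarrow> (M - 1) * (\<sigma> - \<alpha> - \<beta>) < 0"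
  using folded_configuration_iff fold_sign_condition assms by simp

lemma linkage_lengths_rotate: "linkage_lengths \<alpha> \<beta> \<gamma> \<delta> \<Longrightarrow> linkage_lengths \<beta> \<gamma> \<delta> \<alpha>"
  by (auto simp: linkage_lengths_def)

lemma elliptic_type_rotate: "elliptic_type \<alpha> \<beta> \<gamma> \<delta> \<Longrightarrow> elliptic_type \<beta> \<gamma> \<delta> \<alpha>"
  by (auto simp: elliptic_type_def)

theorem mainTheorem6:
  fixes \<alpha> \<beta> \<gamma> \<delta> \<sigma> M :: real
  assumes "linkage_lengths \<alpha> \<beta> \<gamma> \<delta>"
    and "elliptic_type \<alpha> \<beta> \<gamma> \<delta>"
    and "\<sigma> = (\<alpha> + \<beta> + \<gamma> + \<delta>) / 2"
    and "M = \<alpha> * \<beta> * \<gamma> * \<delta> / ((\<sigma> - \<alpha>) * (\<sigma> - \<beta>) * (\<sigma> - \<gamma>) * (\<sigma> - \<delta>))"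
  shows "((\<exists>y z w. (None, y, z, w) \<in> configurations \<alpha> \<beta> \<gamma> \<delta>) \<longleftrightarrow> (M - 1) * (\<sigma> - \<alpha> - \<beta>) < 0) \<and>
         ((\<exists>x z w. (x, None, z, w) \<in> configurations \<alpha> \<beta> \<gamma> \<delta>) \<longleftrightarrow> (M - 1) * (\<sigma> - \<beta> - \<gamma>) < 0) \<and>
         ((\<exists>x y w. (x, y, None, w) \<in> configurations \<alpha> \<beta> \<gamma> \<delta>) \<longleftrightarrow> (M - 1) * (\<sigma> - \<gamma> - \<delta>) < 0) \<and>
         ((\<exists>x y z. (x, y, z, None) \<in> configurations \<alpha> \<beta> \<gamma> \<delta>) \<longleftrightarrow> (M - 1) * (\<sigma> - \<delta> - \<alpha>) < 0)"
proof -
  note l = assms(1) linkage_lengths_rotate[OF assms(1)]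
    linkage_lengths_rotate[OF linkage_lengths_rotate[OF assms(1)]]
    linkage_lengths_rotate[OF linkage_lengths_rotate[OF linkage_lengths_rotate[OF assms(1)]]]
  note e = assms(2) elliptic_type_rotate[OF assms(2)]
    elliptic_type_rotate[OF elliptic_type_rotate[OF assms(2)]]
    elliptic_type_rotate[OF elliptic_type_rotate[OF elliptic_type_rotate[OF assms(2)]]]
  have "(\<exists>y z w. (None, y, z, w) \<in> configurations \<alpha> \<beta> \<gamma> \<delta>) \<longleftrightarrow> (M - 1) * (\<sigma> - \<alpha> - \<beta>) < 0"
    by (rule infinite_half_tan_iff[OF l(1) e(1) assms(3,4)])
  \<comment> \<open>\<open>\<sigma>\<close> and \<open>M\<close> are symmetric in the bars, so the
    same values serve every relabelling.\<close>
  moreover have "(\<exists>z w x. (None, z, w, x) \<in> configurations \<beta> \<gamma> \<delta> \<alpha>) \<longleftrightarrow> (M - 1) * (\<sigma> - \<beta> - \<gamma>) < 0"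
    by (rule infinite_half_tan_iff[OF l(2) e(2)]) (simp_all add: assms(3,4) mult_ac add_ac)
  moreover have "(\<exists>w x y. (None, w, x, y) \<in> configurations \<gamma> \<delta> \<alpha> \<beta>) \<longleftrightarrow> (M - 1) * (\<sigma> - \<gamma> - \<delta>) < 0"
    by (rule infinite_half_tan_iff[OF l(3) e(3)]) (simp_all add: assms(3,4) mult_ac add_ac)
  moreover have "(\<exists>x y z. (None, x, y, z) \<in> configurations \<delta> \<alpha> \<beta> \<gamma>) \<longleftrightarrow> (M - 1) * (\<sigma> - \<delta> - \<alpha>) < 0"
    by (rule infinite_half_tan_iff[OF l(4) e(4)]) (simp_all add: assms(3,4) mult_ac add_ac)
  moreover have "(\<exists>x z w. (x, None, z, w) \<in> configurations \<alpha> \<beta> \<gamma> \<delta>) \<longleftrightarrow>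
      (\<exists>z w x. (None, z, w, x) \<in> configurations \<beta> \<gamma> \<delta> \<alpha>)"
    using configurations_rotate by blast
  moreover have "(\<exists>x y w. (x, y, None, w) \<in> configurations \<alpha> \<beta> \<gamma> \<delta>) \<longleftrightarrow>
      (\<exists>w x y. (None, w, x, y) \<in> configurations \<gamma> \<delta> \<alpha> \<beta>)"
    \<comment> \<open>Two rotations bring \<open>z\<close> to the front; fixing the first bar in
      each rule keeps the rewriting from cycling.\<close>
    unfolding configurations_rotate[of _ _ _ _ \<alpha>] configurations_rotate[of _ _ _ _ \<beta>] by blast
  moreover have "(\<exists>x y z. (x, y, z, None) \<in> configurations \<alpha> \<beta> \<gamma> \<delta>) \<longleftrightarrow>
      (\<exists>x y z. (None, x, y, z) \<in> configurations \<delta> \<alpha> \<beta> \<gamma>)"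
    \<comment> \<open>A single rotation in the reverse direction brings \<open>w\<close> to the
      front.\<close>
    using configurations_rotate by blast
  ultimately show ?thesis
    by simp
qed

end
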